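(* Let $G=(V,E)$ be a non-complete connected (simple, undirected, locally finite) graph with minimum degree $\delta(G)$ and connectivity $k(G)$. Then $$k(G)\geq \delta(G)\,\kappa_{LLY}^{(2)}(G).$$
   Context: The connectivity $k(G)$ of a non-complete graph is the minimum number of vertices whose removal disconnects $G$. $d(x,y)$ is the graph distance and $d_x$ the degree of $x$. For $p\in[0,1]$ and a vertex $x$, $\mu_x^p$ is the probability measure with $\mu_x^p(x)=p$, $\mu_x^p(y)=\frac{1-p}{d_x}$ if $y$ is adjacent to $x$, and $0$ otherwise. For probability measures $\mu_1,\mu_2$ on $V$, the Wasserstein distance is $W(\mu_1,\mu_2)=\inf_\pi\sum_{x,y}d(x,y)\pi(x,y)$ over all $\pi:V\times V\to[0,1]$ with $\sum_y\pi(x,y)=\mu_1(x)$ for all $x$ and $\sum_x\pi(x,y)=\mu_2(y)$ for all $y$. For distinct vertices $x,y$, $\kappa_p(x,y)=1-\frac{W(\mu_x^p,\mu_y^p)}{d(x,y)}$ and the Lin–Lu–Yau curvature is $\kappa_{LLY}(x,y)=\lim_{p\to1}\frac{\kappa_p(x,y)}{1-p}$. For a positive integer $i$, $\kappa_{LLY}^{(i)}(G)=\inf\{\kappa_{LLY}(x,y): x,y\in V,\ d(x,y)=i\}$. *)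

theory Defs
  imports "HOL-Analysis.Analysis" "Graph_Theory.Graph_Theory"
begin

text \<open>
  Undirected edges are represented, as in \<^locale>\<open>graph\<close> of Graph_Theory, by pairs of opposite
  arcs. The locale below is \<^locale>\<open>graph\<close> with finiteness of the whole graph replaced by local
  finiteness, so infinite graphs are included.
\<close>

locale locally_finite_graph =
  loopfree_digraph G + nomulti_digraph G + sym_digraph G for G :: "('a, 'b) pre_digraph" +
  assumes locally_finite: "v \<in> verts G \<Longrightarrow> finite (out_arcs G v)"

definition complete_graph :: "('a, 'b) pre_digraph \<Rightarrow> bool" where
  "complete_graph G \<longleftrightarrow> (\<forall>x\<in>verts G. \<forall>y\<in>verts G. x \<noteq> y \<longrightarrow> x \<rightarrow>\<^bsub>G\<^esub> y)"

text \<open>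
  By symmetry the degree of a vertex is its out-degree.
\<close>

definition min_degree :: "('a, 'b) pre_digraph \<Rightarrow> nat" where
  "min_degree G = (INF x\<in>verts G. out_degree G x)"

text \<open>
  The subset relation is strict because Graph_Theory does not regard the null graph as connected:
  deleting all vertices should not count as disconnecting \<open>G\<close>. A non-complete locally finite graph
  has a separating set that is finite: the neighbourhood of either of two non-adjacent vertices.
  \<open>Digraph_Component.connected\<close> is graph connectedness, not the topological notion of HOL-Analysis.
\<close>

definition separating_set :: "('a, 'b) pre_digraph \<Rightarrow> 'a set \<Rightarrow> bool" where
  "separating_set G S \<longleftrightarrow> S \<subset> verts G \<and> \<not> Digraph_Component.connected (G \<restriction> (verts G - S))"

definition connectivity :: "('a, 'b) pre_digraph \<Rightarrow> nat" where
  "connectivity G = (LEAST k. \<exists>S. separating_set G S \<and> finite S \<and> card S = k)"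

text \<open>
  The shortest-path distance with unit arc weights, which is finite in a connected graph.
\<close>

definition gdist :: "('a, 'b) pre_digraph \<Rightarrow> 'a \<Rightarrow> 'a \<Rightarrow> real" where
  "gdist G x y = real_of_ereal (wf_digraph.\<mu> G (\<lambda>_. 1) x y)"

definition walk_measure :: "('a, 'b) pre_digraph \<Rightarrow> real \<Rightarrow> 'a \<Rightarrow> 'a \<Rightarrow> real" where
  "walk_measure G p x y =
     (if y = x then p else if x \<rightarrow>\<^bsub>G\<^esub> y then (1 - p) / real (out_degree G x) else 0)"

text \<open>
  Probability measures on the vertex set and couplings are given by their mass functions; values
  outside the vertex set are irrelevant. The marginal conditions use \<open>has_sum\<close> rather than
  \<open>infsum\<close>, since the latter is \<open>0\<close> for a divergent sum. Likewise the infimum in the Wasserstein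
  distance ranges over the couplings of finite cost; couplings of infinite cost would not affect it.
  The measures used here have finite support, so all their couplings have finite cost.
\<close>

definition coupling :: "'a set \<Rightarrow> ('a \<Rightarrow> real) \<Rightarrow> ('a \<Rightarrow> real) \<Rightarrow> ('a \<Rightarrow> 'a \<Rightarrow> real) \<Rightarrow> bool" where
  "coupling V \<mu>1 \<mu>2 \<pi> \<longleftrightarrow>
     (\<forall>x\<in>V. \<forall>y\<in>V. \<pi> x y \<in> {0..1}) \<and>
     (\<forall>x\<in>V. ((\<lambda>y. \<pi> x y) has_sum \<mu>1 x) V) \<and>
     (\<forall>y\<in>V. ((\<lambda>x. \<pi> x y) has_sum \<mu>2 y) V)"

definition wasserstein :: "('a, 'b) pre_digraph \<Rightarrow> ('a \<Rightarrow> real) \<Rightarrow> ('a \<Rightarrow> real) \<Rightarrow> real" where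
  "wasserstein G \<mu>1 \<mu>2 =
     Inf {c. \<exists>\<pi>. coupling (verts G) \<mu>1 \<mu>2 \<pi> \<and>
                 ((\<lambda>(x, y). gdist G x y * \<pi> x y) has_sum c) (verts G \<times> verts G)}"

definition kappa :: "('a, 'b) pre_digraph \<Rightarrow> real \<Rightarrow> 'a \<Rightarrow> 'a \<Rightarrow> real" where
  "kappa G p x y = 1 - wasserstein G (walk_measure G p x) (walk_measure G p y) / gdist G x y"

text \<open>
  The limit is from the left because \<open>p\<close> ranges over \<open>[0,1]\<close>.
\<close>

definition kappa_LLY :: "('a, 'b) pre_digraph \<Rightarrow> 'a \<Rightarrow> 'a \<Rightarrow> real" where
  "kappa_LLY G x y = Lim (at_left 1) (\<lambda>p. kappa G p x y / (1 - p))"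

text \<open>
  The infimum is taken in the reals. The set is bounded below, since moving the mass \<open>1 - p\<close> from the
  neighbours back to the centres gives \<open>W \<le> d(x,y) + 2(1 - p)\<close> and hence a curvature of at least
  \<open>-2 / d(x,y)\<close>; for \<open>i = 2\<close> it is nonempty whenever \<open>G\<close> is connected and non-complete.
\<close>

definition kappa_LLY_inf :: "('a, 'b) pre_digraph \<Rightarrow> nat \<Rightarrow> real" where
  "kappa_LLY_inf G i =
     Inf {kappa_LLY G x y | x y. x \<in> verts G \<and> y \<in> verts G \<and> gdist G x y = real i}"

end

theory Submission
  imports Defs
begin

text \<open>
  Let \<open>S\<close> be a minimum separating set, let \<open>X\<close> and \<open>Y\<close> be the two sides it separates, and let \<open>f\<close> be \<open>1\<close>
  on \<open>X\<close>, \<open>0\<close> on \<open>S\<close> and \<open>-1\<close> on \<open>Y\<close>; as no arc joins \<open>X\<close> to \<open>Y\<close>, this function is 1-Lipschitz. By minimality some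
  \<open>s \<in> S\<close> has neighbours \<open>x \<in> X\<close> and \<open>y \<in> Y\<close>, which are at distance 2. Testing the Wasserstein distance
  of the walk measures against \<open>f\<close>, only the neighbours of \<open>x\<close> and \<open>y\<close> in \<open>S\<close> lose, so it is at least
  \<open>2 - 2 * (1 - p) * card S / \<delta>\<close>, and the curvature of \<open>x\<close> and \<open>y\<close> is at most \<open>card S / \<delta>\<close>. The limit
  defining the curvature exists because \<open>\<kappa>\<^sub>p / (1 - p)\<close> is bounded and increases with \<open>p\<close>: mixing a
  coupling with the Dirac coupling of the centres shows that \<open>\<kappa>\<^sub>p\<close> lies above its chords to \<open>p = 1\<close>.
\<close>

section \<open>Couplings of finitely supported measures\<close>

text \<open>A nonnegative family with sum 0 vanishes termwise, so a coupling lives on the product of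
  the supports. This turns sums over \<open>V\<close> into finite ones.\<close>

lemma coupling_outside_support:
  assumes "coupling V \<mu>1 \<mu>2 \<pi>" "u \<in> V" "v \<in> V" "\<mu>1 u = 0 \<or> \<mu>2 v = 0"
  shows "\<pi> u v = 0"
proof -
  have nn: "\<And>a b. a \<in> V \<Longrightarrow> b \<in> V \<Longrightarrow> 0 \<le> \<pi> a b"
    and s1: "((\<lambda>b. \<pi> u b) has_sum \<mu>1 u) V" and s2: "((\<lambda>a. \<pi> a v) has_sum \<mu>2 v) V"
    using assms unfolding coupling_def by auto
  from assms(4) show ?thesis
  proof
    assume "\<mu>1 u = 0"
    then show ?thesis using nonneg_has_sum_le_0D[OF s1] nn assms by auto
  next
    assume "\<mu>2 v = 0"
    then show ?thesis using nonneg_has_sum_le_0D[OF s2] nn assms by auto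
  qed
qed

lemma coupling_row_sum:
  assumes "coupling V \<mu>1 \<mu>2 \<pi>" "u \<in> V" "finite B" "B \<subseteq> V" "\<And>v. v \<in> V - B \<Longrightarrow> \<mu>2 v = 0"
  shows "(\<Sum>v\<in>B. \<pi> u v) = \<mu>1 u"
proof -
  have "((\<lambda>v. \<pi> u v) has_sum (\<Sum>v\<in>B. \<pi> u v)) V"
    by (rule has_sum_finite_neutralI[OF assms(3,4)])
       (use assms coupling_outside_support[OF assms(1,2)] in auto)
  moreover have "((\<lambda>v. \<pi> u v) has_sum \<mu>1 u) V"
    using assms unfolding coupling_def by auto
  ultimately show ?thesis by (rule has_sum_unique)
qed

lemma coupling_column_sum:
  assumes "coupling V \<mu>1 \<mu>2 \<pi>" "v \<in> V" "finite A" "A \<subseteq> V" "\<And>u. u \<in> V - A \<Longrightarrow> \<mu>1 u = 0"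
  shows "(\<Sum>u\<in>A. \<pi> u v) = \<mu>2 v"
proof -
  have "((\<lambda>u. \<pi> u v) has_sum (\<Sum>u\<in>A. \<pi> u v)) V"
    by (rule has_sum_finite_neutralI[OF assms(3,4)])
       (use assms coupling_outside_support[OF assms(1) _ assms(2)] in auto)
  moreover have "((\<lambda>u. \<pi> u v) has_sum \<mu>2 v) V"
    using assms unfolding coupling_def by auto
  ultimately show ?thesis by (rule has_sum_unique)
qed

text \<open>For finitely supported marginals the cost is a finite sum. With \<open>g\<close> the
  distance, every coupling therefore enters the infimum defining \<open>wasserstein\<close>.\<close>

lemma coupling_cost_has_sum:
  assumes "coupling V \<mu>1 \<mu>2 \<pi>"
    and "finite A" "A \<subseteq> V" "\<And>u. u \<in> V - A \<Longrightarrow> \<mu>1 u = 0"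
    and "finite B" "B \<subseteq> V" "\<And>v. v \<in> V - B \<Longrightarrow> \<mu>2 v = 0"
  shows "((\<lambda>(u, v). g u v * \<pi> u v) has_sum (\<Sum>u\<in>A. \<Sum>v\<in>B. g u v * \<pi> u v)) (V \<times> V)"
proof (rule has_sum_finite_neutralI[where B = "A \<times> B"])
  show "(\<Sum>u\<in>A. \<Sum>v\<in>B. g u v * \<pi> u v) = (\<Sum>(u, v)\<in>A \<times> B. g u v * \<pi> u v)"
    by (simp add: sum.cartesian_product)
  show "(case z of (u, v) \<Rightarrow> g u v * \<pi> u v) = 0" if "z \<in> V \<times> V - A \<times> B" for z
    using that assms(4,7) coupling_outside_support[OF assms(1)] by (cases z) force
qed (use assms in auto)

text \<open>The independent coupling shows that couplings exist; the real \<open>Inf\<close> of an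
  empty set would carry no information.\<close>

lemma coupling_product:
  fixes \<mu>1 \<mu>2 :: "'a \<Rightarrow> real"
  assumes A: "finite A" "A \<subseteq> V" "\<And>u. u \<in> V - A \<Longrightarrow> \<mu>1 u = 0" "\<And>u. u \<in> A \<Longrightarrow> 0 \<le> \<mu>1 u" "sum \<mu>1 A = 1"
    and B: "finite B" "B \<subseteq> V" "\<And>v. v \<in> V - B \<Longrightarrow> \<mu>2 v = 0" "\<And>v. v \<in> B \<Longrightarrow> 0 \<le> \<mu>2 v" "sum \<mu>2 B = 1"
  shows "coupling V \<mu>1 \<mu>2 (\<lambda>u v. \<mu>1 u * \<mu>2 v)"
proof -
  have nn1: "0 \<le> \<mu>1 u" if "u \<in> V" for u using that A by (cases "u \<in> A") auto
  have nn2: "0 \<le> \<mu>2 u" if "u \<in> V" for u using that B by (cases "u \<in> B") auto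
  have le1: "\<mu>1 u \<le> 1" if "u \<in> V" for u
    using that A member_le_sum[of u A \<mu>1] by (cases "u \<in> A") auto
  have le2: "\<mu>2 u \<le> 1" if "u \<in> V" for u
    using that B member_le_sum[of u B \<mu>2] by (cases "u \<in> B") auto
  have "((\<lambda>v. \<mu>1 u * \<mu>2 v) has_sum \<mu>1 u) V" for u
    by (rule has_sum_finite_neutralI[OF B(1,2)]) (use B in \<open>auto simp flip: sum_distrib_left\<close>)
  moreover have "((\<lambda>u. \<mu>1 u * \<mu>2 v) has_sum \<mu>2 v) V" for v
    by (rule has_sum_finite_neutralI[OF A(1,2)]) (use A in \<open>auto simp flip: sum_distrib_right\<close>)
  ultimately show ?thesis
    unfolding coupling_def using nn1 nn2 le1 le2 by (auto intro: mult_le_one)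
qed

text \<open>The easy half of Kantorovich--Rubinstein duality.\<close>

lemma coupling_cost_ge_Lipschitz:
  fixes f :: "'a \<Rightarrow> real"
  assumes "coupling V \<mu>1 \<mu>2 \<pi>"
    and A: "finite A" "A \<subseteq> V" "\<And>u. u \<in> V - A \<Longrightarrow> \<mu>1 u = 0"
    and B: "finite B" "B \<subseteq> V" "\<And>v. v \<in> V - B \<Longrightarrow> \<mu>2 v = 0"
    and "\<And>u v. u \<in> V \<Longrightarrow> v \<in> V \<Longrightarrow> f u - f v \<le> g u v"
    and "((\<lambda>(u, v). g u v * \<pi> u v) has_sum c) (V \<times> V)"
  shows "(\<Sum>u\<in>A. f u * \<mu>1 u) - (\<Sum>v\<in>B. f v * \<mu>2 v) \<le> c"
proof -
  have c: "c = (\<Sum>u\<in>A. \<Sum>v\<in>B. g u v * \<pi> u v)"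
    using has_sum_unique[OF assms(9) coupling_cost_has_sum[OF assms(1) A B]] .
  have "(\<Sum>u\<in>A. f u * \<mu>1 u) = (\<Sum>u\<in>A. f u * (\<Sum>v\<in>B. \<pi> u v))"
    using coupling_row_sum[OF assms(1) _ B] A(2) by (intro sum.cong) auto
  moreover have "(\<Sum>v\<in>B. f v * \<mu>2 v) = (\<Sum>v\<in>B. f v * (\<Sum>u\<in>A. \<pi> u v))"
    using coupling_column_sum[OF assms(1) _ A] B(2) by (intro sum.cong) auto
  moreover have "\<dots> = (\<Sum>u\<in>A. \<Sum>v\<in>B. f v * \<pi> u v)"
    by (simp add: sum_distrib_left sum.swap[of _ B A])
  ultimately have "(\<Sum>u\<in>A. f u * \<mu>1 u) - (\<Sum>v\<in>B. f v * \<mu>2 v)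
      = (\<Sum>u\<in>A. \<Sum>v\<in>B. (f u - f v) * \<pi> u v)"
    by (simp add: sum_distrib_left left_diff_distrib sum_subtractf)
  also have "\<dots> \<le> (\<Sum>u\<in>A. \<Sum>v\<in>B. g u v * \<pi> u v)"
    using assms(1,8) A(2) B(2) unfolding coupling_def
    by (intro sum_mono mult_right_mono) (auto simp: subset_iff)
  finally show ?thesis using c by simp
qed

text \<open>Couplings are stable under convex combination, and the point mass at
  \<open>(x, y)\<close> couples the Dirac measures at \<open>x\<close> and \<open>y\<close>.\<close>

lemma coupling_mix_Dirac:
  assumes "coupling V \<mu>1 \<mu>2 \<pi>" "x \<in> V" "y \<in> V" "0 \<le> t" "t \<le> 1"
  shows "coupling V (\<lambda>u. t * \<mu>1 u + (1 - t) * of_bool (u = x)) (\<lambda>v. t * \<mu>2 v + (1 - t) * of_bool (v = y))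
    (\<lambda>u v. t * \<pi> u v + (1 - t) * of_bool (u = x \<and> v = y))"
proof -
  have row: "((\<lambda>v. (1 - t) * of_bool (u = x \<and> v = y)) has_sum ((1 - t) * of_bool (u = x))) V" for u
    by (rule has_sum_finite_neutralI[where B = "{y}"]) (use assms in auto)
  have column: "((\<lambda>u. (1 - t) * of_bool (u = x \<and> v = y)) has_sum ((1 - t) * of_bool (v = y))) V" for v
    by (rule has_sum_finite_neutralI[where B = "{x}"]) (use assms in auto)
  have range: "0 \<le> t * a + (1 - t) * of_bool P \<and> t * a + (1 - t) * of_bool P \<le> 1"
    if "0 \<le> a" "a \<le> 1" for a P
    using that assms(4,5) convex_bound_le[of a 1 "of_bool P" t "1 - t"] by auto
  show ?thesis
    unfolding coupling_def
  proof (intro conjI ballI)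
    fix u v assume "u \<in> V" "v \<in> V"
    then show "t * \<pi> u v + (1 - t) * of_bool (u = x \<and> v = y) \<in> {0..1}"
      using range assms(1) unfolding coupling_def by simp
  qed (rule has_sum_add[OF has_sum_cmult_right row] has_sum_add[OF has_sum_cmult_right column];
       use assms(1) in \<open>simp add: coupling_def\<close>)+
qed

lemma eventually_unit_interval: "eventually (\<lambda>p. 0 \<le> p \<and> p < (1::real)) (at_left 1)"
  using eventually_at_left_real[of 0 1] by (auto elim: eventually_mono)

lemma (in wf_digraph) reachable_closed:
  assumes "u \<rightarrow>\<^sup>*\<^bsub>G\<^esub> v" "u \<in> X" "\<And>a b. a \<in> X \<Longrightarrow> a \<rightarrow>\<^bsub>G\<^esub> b \<Longrightarrow> b \<in> X"
  shows "v \<in> X"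
  using assms(1) by (induction rule: reachable_induct) (use assms(2,3) in blast)+

section \<open>Neighbourhoods and distance in a connected graph\<close>

locale connected_locally_finite_graph = locally_finite_graph +
  assumes connected: "Digraph_Component.connected G"
begin

abbreviation nbrs :: "'a \<Rightarrow> 'a set" where "nbrs x \<equiv> {y. x \<rightarrow>\<^bsub>G\<^esub> y}"

abbreviation gd :: "'a \<Rightarrow> 'a \<Rightarrow> real" where "gd \<equiv> gdist G"

lemma reachable_verts: "u \<in> verts G \<Longrightarrow> v \<in> verts G \<Longrightarrow> u \<rightarrow>\<^sup>*\<^bsub>G\<^esub> v"
  using symmetric_connected_imp_strongly_connected[OF sym_arcs connected] by blast

lemma nbrs_subset_verts: "nbrs x \<subseteq> verts G"
  by (auto intro: adj_in_verts)

lemma nbrs_conv_out_arcs: "nbrs x = head G ` out_arcs G x"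
  by (auto simp: arcs_ends_conv out_arcs_def)

lemma finite_nbrs: "x \<in> verts G \<Longrightarrow> finite (nbrs x)"
  unfolding nbrs_conv_out_arcs by (simp add: locally_finite)

lemma card_nbrs: "card (nbrs x) = out_degree G x"
proof -
  \<comment> \<open>Without parallel arcs an out-arc of \<open>x\<close> is determined by its
    head.\<close>
  have "inj_on (head G) (out_arcs G x)"
    by (auto simp: inj_on_def out_arcs_def arc_to_ends_def intro!: no_multi_arcs)
  then show ?thesis unfolding nbrs_conv_out_arcs out_degree_def by (rule card_image)
qed

text \<open>With unit weights the cost of a walk is its length, a natural number, so the infimum in
  \<open>\<mu>\<close> is attained and finite, and \<open>real_of_ereal\<close> loses
  nothing.\<close>

lemma gdist_realized:
  assumes "u \<in> verts G" "v \<in> verts G"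
  obtains p where "awalk u p v" "gd u v = real (length p)" "\<And>q. awalk u q v \<Longrightarrow> length p \<le> length q"
proof -
  have cost: "awalk_cost (\<lambda>_. 1) p = real (length p)" for p
    by (induction p) auto
  obtain q where "awalk u q v" using reachable_verts[OF assms] reachable_awalk by auto
  then obtain p where p: "awalk u p v" "\<And>q. awalk u q v \<Longrightarrow> length p \<le> length q"
    using ex_has_least_nat[of "\<lambda>p. awalk u p v" q length] by blast
  have "\<mu> (\<lambda>_. 1) u v = ereal (real (length p))"
    unfolding \<mu>_def cost using p by (intro antisym INF_lower2[of p] INF_greatest) auto
  then show ?thesis using p that unfolding gdist_def by simp
qed

lemma gdist_le_length:
  assumes "awalk u p v"
  shows "gd u v \<le> real (length p)"
proof -
  have "u \<in> verts G" "v \<in> verts G" using assms by auto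
  from gdist_realized[OF this] assms show ?thesis by (metis of_nat_le_iff)
qed

lemma gdist_nonneg: "u \<in> verts G \<Longrightarrow> v \<in> verts G \<Longrightarrow> 0 \<le> gd u v"
  using gdist_realized[of u v] by (metis of_nat_0_le_iff)

lemma gdist_self: "u \<in> verts G \<Longrightarrow> gd u u = 0"
  using gdist_le_length[of u "[]" u] gdist_nonneg[of u u] by (auto simp: awalk_Nil_iff)

lemma gdist_triangle:
  assumes "u \<in> verts G" "v \<in> verts G" "w \<in> verts G"
  shows "gd u w \<le> gd u v + gd v w"
proof -
  obtain p where p: "awalk u p v" "gd u v = real (length p)" using gdist_realized assms by metis
  obtain q where q: "awalk v q w" "gd v w = real (length q)" using gdist_realized assms by metis
  have "awalk u (p @ q) w" using p q by auto
  from gdist_le_length[OF this] show ?thesis using p q by simp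
qed

lemma gdist_adj_le_1:
  assumes "u \<rightarrow>\<^bsub>G\<^esub> v"
  shows "gd u v \<le> 1"
proof -
  obtain e where "e \<in> arcs G" "tail G e = u" "head G e = v" using assms by (auto simp: arcs_ends_conv)
  then have "awalk u [e] v" by (auto simp: awalk_Cons_iff awalk_Nil_iff)
  from gdist_le_length[OF this] show ?thesis by simp
qed

lemma gdist_ge_1:
  assumes "u \<in> verts G" "v \<in> verts G" "u \<noteq> v"
  shows "1 \<le> gd u v"
proof -
  obtain p where p: "awalk u p v" "gd u v = real (length p)" using gdist_realized assms by metis
  with assms show ?thesis by (cases p) (auto simp: awalk_Nil_iff)
qed

lemma gdist_ge_2:
  assumes "u \<in> verts G" "v \<in> verts G" "u \<noteq> v" "\<not> u \<rightarrow>\<^bsub>G\<^esub> v"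
  shows "2 \<le> gd u v"
proof -
  obtain p where p: "awalk u p v" "gd u v = real (length p)" using gdist_realized assms by metis
  with assms show ?thesis
    by (cases p; cases "tl p") (auto simp: awalk_Nil_iff awalk_Cons_iff arcs_ends_conv)
qed

text \<open>A walk from \<open>x\<close> to a different vertex must begin with an arc. This keeps
  the divisions by \<open>out_degree\<close> meaningful.\<close>

lemma out_degree_pos:
  assumes "x \<in> verts G" "y \<in> verts G" "x \<noteq> y"
  shows "0 < out_degree G x"
proof -
  obtain z where "x \<rightarrow>\<^bsub>G\<^esub> z"
    using reachable_verts[OF assms(1,2)] assms(3) by (cases rule: converse_reachable_cases) auto
  then show ?thesis using finite_nbrs[OF assms(1)] by (auto simp: card_gt_0_iff simp flip: card_nbrs)
qed

section \<open>Walk measures\<close>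

lemma walk_measure_outside: "u \<notin> insert x (nbrs x) \<Longrightarrow> walk_measure G p x u = 0"
  by (auto simp: walk_measure_def)

lemma walk_measure_nonneg: "0 \<le> p \<Longrightarrow> p \<le> 1 \<Longrightarrow> 0 \<le> walk_measure G p x u"
  by (auto simp: walk_measure_def)

text \<open>The expectation of \<open>f\<close> is its value at the centre plus \<open>1 - p\<close>
  times the normalized graph Laplacian of \<open>f\<close> at \<open>x\<close>, so its dependence on
  \<open>p\<close> is explicitly affine.\<close>

lemma sum_walk_measure:
  fixes f :: "'a \<Rightarrow> real"
  assumes "x \<in> verts G" "0 < out_degree G x"
  shows "(\<Sum>z\<in>insert x (nbrs x). f z * walk_measure G p x z)
    = f x + (1 - p) * ((\<Sum>z\<in>nbrs x. f z - f x) / out_degree G x)"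
proof -
  have not_nbr: "x \<notin> nbrs x" using adj_not_same by blast
  have "(\<Sum>z\<in>nbrs x. f z * walk_measure G p x z) = (\<Sum>z\<in>nbrs x. f z * ((1 - p) / out_degree G x))"
    by (intro sum.cong) (auto simp: walk_measure_def dest: adj_not_same)
  also have "\<dots> = (\<Sum>z\<in>nbrs x. f z) * ((1 - p) / out_degree G x)"
    by (rule sum_distrib_right[symmetric])
  finally have sum: "(\<Sum>z\<in>insert x (nbrs x). f z * walk_measure G p x z)
      = f x * p + (\<Sum>z\<in>nbrs x. f z) * ((1 - p) / out_degree G x)"
    using finite_nbrs[OF assms(1)] not_nbr by (simp add: walk_measure_def)
  have diff: "(\<Sum>z\<in>nbrs x. f z - f x) = (\<Sum>z\<in>nbrs x. f z) - out_degree G x * f x"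
    by (simp add: sum_subtractf card_nbrs)
  show ?thesis unfolding sum diff using assms(2) by (simp add: field_simps)
qed

lemma total_walk_measure:
  assumes "x \<in> verts G" "0 < out_degree G x"
  shows "sum (walk_measure G p x) (insert x (nbrs x)) = 1"
  using sum_walk_measure[OF assms, of "\<lambda>_. 1"] by simp

lemma walk_measure_support:
  assumes "x \<in> verts G"
  shows "finite (insert x (nbrs x))" "insert x (nbrs x) \<subseteq> verts G"
    "\<And>u. u \<in> verts G - insert x (nbrs x) \<Longrightarrow> walk_measure G p x u = 0"
  using assms finite_nbrs nbrs_subset_verts walk_measure_outside by auto

section \<open>Wasserstein distance between walk measures\<close>

abbreviation W :: "real \<Rightarrow> 'a \<Rightarrow> 'a \<Rightarrow> real" where
  "W p x y \<equiv> wasserstein G (walk_measure G p x) (walk_measure G p y)"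

text \<open>Costs are nonnegative, so their set is bounded below and its real \<open>Inf\<close> is
  a genuine lower bound.\<close>

lemma wasserstein_le:
  assumes "coupling (verts G) \<mu>1 \<mu>2 \<pi>"
    and "((\<lambda>(x, y). gdist G x y * \<pi> x y) has_sum c) (verts G \<times> verts G)"
  shows "wasserstein G \<mu>1 \<mu>2 \<le> c"
  unfolding wasserstein_def
proof (rule cInf_lower)
  show "bdd_below {c. \<exists>\<pi>. coupling (verts G) \<mu>1 \<mu>2 \<pi> \<and>
      ((\<lambda>(x, y). gdist G x y * \<pi> x y) has_sum c) (verts G \<times> verts G)}"
    by (rule bdd_belowI[of _ 0])
       (auto simp: coupling_def intro!: mult_nonneg_nonneg gdist_nonneg elim!: has_sum_nonneg)
qed (use assms in auto)

context
  fixes x y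
  assumes xV: "x \<in> verts G" and yV: "y \<in> verts G" and xy: "x \<noteq> y"
begin

lemma product_coupling:
  assumes "0 \<le> p" "p \<le> 1"
  shows "coupling (verts G) (walk_measure G p x) (walk_measure G p y)
    (\<lambda>u v. walk_measure G p x u * walk_measure G p y v)"
  by (rule coupling_product[where A = "insert x (nbrs x)" and B = "insert y (nbrs y)"])
     (use assms walk_measure_support xV yV in
      \<open>auto intro!: walk_measure_nonneg total_walk_measure out_degree_pos[OF xV yV] out_degree_pos[OF yV xV] xy xy[symmetric]
        simp del: sum.insert\<close>)

lemma wasserstein_greatest:
  assumes "0 \<le> p" "p \<le> 1"
    and "\<And>c \<pi>. coupling (verts G) (walk_measure G p x) (walk_measure G p y) \<pi> \<Longrightarrow>
      ((\<lambda>(u, v). gd u v * \<pi> u v) has_sum c) (verts G \<times> verts G) \<Longrightarrow> K \<le> c"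
  shows "K \<le> W p x y"
  unfolding wasserstein_def
  by (rule cInf_greatest)
     (use assms(3) product_coupling[OF assms(1,2)]
        coupling_cost_has_sum[OF product_coupling[OF assms(1,2)] walk_measure_support[OF xV] walk_measure_support[OF yV]]
      in blast)+

text \<open>Each coupling cost is at least the difference of the two expectations of
  \<open>f\<close>, here split into the values at the centres and the Laplacian terms.\<close>

lemma wasserstein_ge_Lipschitz:
  fixes f :: "'a \<Rightarrow> real"
  assumes "0 \<le> p" "p \<le> 1"
    and "\<And>u v. u \<in> verts G \<Longrightarrow> v \<in> verts G \<Longrightarrow> f u - f v \<le> gd u v"
  shows "f x - f y + (1 - p) * ((\<Sum>z\<in>nbrs x. f z - f x) / out_degree G x
    - (\<Sum>z\<in>nbrs y. f z - f y) / out_degree G y) \<le> W p x y"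
proof (rule wasserstein_greatest[OF assms(1,2)])
  fix c \<pi>
  assume "coupling (verts G) (walk_measure G p x) (walk_measure G p y) \<pi>"
    and "((\<lambda>(u, v). gd u v * \<pi> u v) has_sum c) (verts G \<times> verts G)"
  from coupling_cost_ge_Lipschitz[OF this(1) walk_measure_support[OF xV] walk_measure_support[OF yV] assms(3) this(2)]
  have "(\<Sum>u\<in>insert x (nbrs x). f u * walk_measure G p x u)
      - (\<Sum>v\<in>insert y (nbrs y). f v * walk_measure G p y v) \<le> c" .
  then show "f x - f y + (1 - p) * ((\<Sum>z\<in>nbrs x. f z - f x) / out_degree G x
      - (\<Sum>z\<in>nbrs y. f z - f y) / out_degree G y) \<le> c"
    unfolding sum_walk_measure[OF xV out_degree_pos[OF xV yV xy]]
      sum_walk_measure[OF yV out_degree_pos[OF yV xV xy[symmetric]]]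
    by (simp add: algebra_simps)
qed

text \<open>
  The walk measure with laziness \<open>1 - t * (1 - p)\<close> is the mixture with weights \<open>t\<close> and \<open>1 - t\<close> of the
  walk measure with laziness \<open>p\<close> and the Dirac mass at the centre.
\<close>

lemma wasserstein_mix:
  assumes "0 \<le> p" "p < 1" "0 < t" "t \<le> 1"
  shows "W (1 - t * (1 - p)) x y \<le> t * W p x y + (1 - t) * gd x y"
proof -
  have mix: "walk_measure G (1 - t * (1 - p)) z = (\<lambda>u. t * walk_measure G p z u + (1 - t) * of_bool (u = z))" for z
    by (auto simp: walk_measure_def fun_eq_iff algebra_simps)
  \<comment> \<open>Solved for \<open>W p x y\<close>, the claim bounds an infimum from below, so it
    suffices to mix one arbitrary coupling.\<close>
  have "(W (1 - t * (1 - p)) x y - (1 - t) * gd x y) / t \<le> W p x y"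
  proof (rule wasserstein_greatest)
    fix c \<pi>
    assume cp: "coupling (verts G) (walk_measure G p x) (walk_measure G p y) \<pi>"
      and c: "((\<lambda>(u, v). gd u v * \<pi> u v) has_sum c) (verts G \<times> verts G)"
    have "((\<lambda>(u, v). (1 - t) * (gd u v * of_bool (u = x \<and> v = y))) has_sum ((1 - t) * gd x y)) (verts G \<times> verts G)"
      by (rule has_sum_finite_neutralI[where B = "{(x, y)}"]) (use xV yV in auto)
    from has_sum_add[OF has_sum_cmult_right[OF c, of t] this]
    have "((\<lambda>(u, v). gd u v * (t * \<pi> u v + (1 - t) * of_bool (u = x \<and> v = y)))
        has_sum (t * c + (1 - t) * gd x y)) (verts G \<times> verts G)"
      by (simp add: case_prod_unfold algebra_simps)
    then have "W (1 - t * (1 - p)) x y \<le> t * c + (1 - t) * gd x y"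
      unfolding mix using assms by (intro wasserstein_le[OF coupling_mix_Dirac[OF cp xV yV]]) auto
    then show "(W (1 - t * (1 - p)) x y - (1 - t) * gd x y) / t \<le> c"
      using assms by (simp add: field_simps)
  qed (use assms in auto)
  then show ?thesis using assms by (simp add: field_simps)
qed

section \<open>Existence of the limit curvature and bounds for it\<close>

text \<open>Write \<open>q = 1 - t * (1 - p)\<close>. The mixing inequality becomes
  \<open>t * kappa G p x y \<le> kappa G q x y\<close>; divide by
  \<open>1 - q = t * (1 - p)\<close>.\<close>

lemma kappa_slope_mono:
  assumes "0 \<le> p" "p \<le> q" "q < 1"
  shows "kappa G p x y / (1 - p) \<le> kappa G q x y / (1 - q)"
proof -
  define t where "t = (1 - q) / (1 - p)"
  have t: "0 < t" "t \<le> 1" "1 - t * (1 - p) = q" using assms by (auto simp: t_def)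
  have d: "0 < gd x y" using gdist_ge_1[OF xV yV xy] by simp
  have "W q x y \<le> t * W p x y + (1 - t) * gd x y" using wasserstein_mix[of p t] t assms by simp
  then have "W q x y / gd x y \<le> t * (W p x y / gd x y) + (1 - t)"
    using d by (simp add: field_simps)
  then have "t * kappa G p x y \<le> kappa G q x y" unfolding kappa_def by (simp add: algebra_simps)
  then show ?thesis using assms unfolding t_def by (simp add: field_simps)
qed

text \<open>Because \<open>f\<close> attains the distance, the leading term of the dual bound
  cancels the \<open>1\<close> in \<open>kappa\<close>. What remains is proportional to
  \<open>1 - p\<close>, with one \<open>M\<close> from each endpoint.\<close>

lemma kappa_slope_le_Lipschitz:
  fixes f :: "'a \<Rightarrow> real"
  assumes "0 \<le> p" "p < 1"
    and "\<And>u v. u \<in> verts G \<Longrightarrow> v \<in> verts G \<Longrightarrow> f u - f v \<le> gd u v" "f x - f y = gd x y"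
    and "- M \<le> (\<Sum>z\<in>nbrs x. f z - f x) / out_degree G x"
    and "(\<Sum>z\<in>nbrs y. f z - f y) / out_degree G y \<le> M"
  shows "kappa G p x y / (1 - p) \<le> 2 * M / gd x y"
proof -
  have d: "0 < gd x y" using gdist_ge_1[OF xV yV xy] by simp
  have "(1 - p) * (- M - M) \<le> (1 - p) * ((\<Sum>z\<in>nbrs x. f z - f x) / out_degree G x
      - (\<Sum>z\<in>nbrs y. f z - f y) / out_degree G y)"
    using assms by (intro mult_left_mono) auto
  also have "gd x y + \<dots> \<le> W p x y"
    using wasserstein_ge_Lipschitz[of p f] assms by simp
  finally have "gd x y - W p x y \<le> (1 - p) * (2 * M)" by (simp add: algebra_simps)
  then have "(gd x y - W p x y) / gd x y \<le> (1 - p) * (2 * M) / gd x y"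
    using d by (intro divide_right_mono) auto
  then have "kappa G p x y \<le> (1 - p) * (2 * M) / gd x y"
    unfolding kappa_def using d by (simp add: diff_divide_distrib)
  then show ?thesis using assms(2) by (simp add: field_simps)
qed

text \<open>The distance to \<open>y\<close> is a test function that attains \<open>gd x y\<close>
  and changes by at most 1 along an arc, so \<open>M = 1\<close> is admissible.\<close>

lemma kappa_slope_bounded:
  assumes "0 \<le> p" "p < 1"
  shows "kappa G p x y / (1 - p) \<le> 2 / gd x y"
proof -
  let ?f = "\<lambda>u. gd u y"
  have Lipschitz: "?f u - ?f v \<le> gd u v" if "u \<in> verts G" "v \<in> verts G" for u v
    using gdist_triangle[OF that yV] by simp
  have diff: "?f x - ?f y = gd x y" using gdist_self[OF yV] by simp
  have "- 1 \<le> gd z y - gd x y" if "z \<in> nbrs x" for z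
    using that gdist_triangle[OF xV _ yV, of z] gdist_adj_le_1[of x z] nbrs_subset_verts[of x] by auto
  then have "(\<Sum>z\<in>nbrs x. - 1) \<le> (\<Sum>z\<in>nbrs x. gd z y - gd x y)" by (intro sum_mono)
  then have lower: "- 1 \<le> (\<Sum>z\<in>nbrs x. gd z y - gd x y) / out_degree G x"
    using out_degree_pos[OF xV yV xy] by (simp add: card_nbrs field_simps)
  have "gd z y - gd y y \<le> 1" if "z \<in> nbrs y" for z
    using that gdist_adj_le_1[of z y] graph_symmetric gdist_self[OF yV] by auto
  then have "(\<Sum>z\<in>nbrs y. gd z y - gd y y) \<le> (\<Sum>z\<in>nbrs y. 1)" by (intro sum_mono)
  then have upper: "(\<Sum>z\<in>nbrs y. gd z y - gd y y) / out_degree G y \<le> 1"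
    using out_degree_pos[OF yV xV xy[symmetric]] by (simp add: card_nbrs field_simps)
  show ?thesis
    using kappa_slope_le_Lipschitz[OF assms, of ?f 1] Lipschitz diff lower upper by simp
qed

text \<open>The quotient is monotone and bounded above on [0,1), so it converges to its supremum.
  Without convergence the \<open>Lim\<close> in \<open>kappa_LLY\<close> would say nothing.\<close>

lemma kappa_LLY_tendsto: "((\<lambda>p. kappa G p x y / (1 - p)) \<longlongrightarrow> kappa_LLY G x y) (at_left 1)"
proof -
  have "((\<lambda>p. kappa G p x y / (1 - p)) \<longlongrightarrow> Sup ((\<lambda>p. kappa G p x y / (1 - p)) ` ({..<1} \<inter> {0..})))
      (at 1 within ({..<1} \<inter> {0..}))"
    by (rule Lim_left_bound) (auto intro: kappa_slope_mono kappa_slope_bounded)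
  \<comment> \<open>The two sets agree on the neighbourhood \<open>{0<..}\<close> of 1.\<close>
  moreover have "at 1 within ({..<1} \<inter> {0..}) = at_left (1::real)"
    by (rule at_within_nhd[of _ "{0<..}"]) auto
  ultimately have *: "((\<lambda>p. kappa G p x y / (1 - p)) \<longlongrightarrow> Sup ((\<lambda>p. kappa G p x y / (1 - p)) ` ({..<1} \<inter> {0..})))
      (at_left 1)" by simp
  then show ?thesis unfolding kappa_LLY_def using tendsto_Lim[OF _ *] by simp
qed

lemma kappa_LLY_le:
  assumes "\<And>p. 0 \<le> p \<Longrightarrow> p < 1 \<Longrightarrow> kappa G p x y / (1 - p) \<le> K"
  shows "kappa_LLY G x y \<le> K"
  by (rule tendsto_upperbound[OF kappa_LLY_tendsto eventually_mono[OF eventually_unit_interval]])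
     (use assms in auto)

lemma kappa_LLY_ge_kappa_0: "kappa G 0 x y \<le> kappa_LLY G x y"
  by (rule tendsto_lowerbound[OF kappa_LLY_tendsto eventually_mono[OF eventually_unit_interval]])
     (use kappa_slope_mono[of 0] in auto)

text \<open>At \<open>p = 0\<close> all mass lies within distance 1 of the centres, so the product
  coupling costs at most \<open>gd x y + 2\<close>. Monotonicity carries the resulting bound to the
  limit.\<close>

lemma kappa_LLY_lower_bound: "- 2 / gd x y \<le> kappa_LLY G x y"
proof -
  let ?A = "insert x (nbrs x)" and ?B = "insert y (nbrs y)"
  let ?m = "\<lambda>z. walk_measure G 0 z"
  have d: "0 < gd x y" using gdist_ge_1[OF xV yV xy] by simp
  have "gd u v \<le> gd x y + 2" if "u \<in> ?A" "v \<in> ?B" for u v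
  proof -
    have V: "u \<in> verts G" "v \<in> verts G" using that walk_measure_support xV yV by blast+
    have "gd u x \<le> 1" using that gdist_self xV gdist_adj_le_1 graph_symmetric by auto
    moreover have "gd y v \<le> 1" using that gdist_self yV gdist_adj_le_1 by auto
    ultimately show ?thesis
      using gdist_triangle[OF V(1) xV V(2)] gdist_triangle[OF xV yV V(2)] by simp
  qed
  then have "(\<Sum>u\<in>?A. \<Sum>v\<in>?B. gd u v * (?m x u * ?m y v))
      \<le> (\<Sum>u\<in>?A. \<Sum>v\<in>?B. (gd x y + 2) * (?m x u * ?m y v))"
    by (intro sum_mono mult_right_mono mult_nonneg_nonneg walk_measure_nonneg) auto
  also have "\<dots> = (gd x y + 2) * (sum (?m x) ?A * sum (?m y) ?B)"
    by (simp only: sum_product) (simp only: sum_distrib_left)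
  also have "\<dots> = gd x y + 2"
    using total_walk_measure xV yV out_degree_pos xy by (simp del: sum.insert)
  finally have "W 0 x y \<le> gd x y + 2"
    using wasserstein_le[OF product_coupling coupling_cost_has_sum[OF product_coupling walk_measure_support[OF xV] walk_measure_support[OF yV]]]
    by (rule order_trans[rotated]) auto
  then have "- 2 / gd x y \<le> kappa G 0 x y"
    unfolding kappa_def using d by (simp add: field_simps)
  then show ?thesis using kappa_LLY_ge_kappa_0 by simp
qed

end

text \<open>The lower bound \<open>- 2 / real i\<close> is uniform over pairs at distance
  \<open>i\<close>, so the real \<open>Inf\<close> behaves as intended. Positivity of
  \<open>i\<close> forces the two vertices to be distinct.\<close>

lemma kappa_LLY_inf_le:
  assumes "x \<in> verts G" "y \<in> verts G" "gd x y = real i" "0 < i"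
  shows "kappa_LLY_inf G i \<le> kappa_LLY G x y"
  unfolding kappa_LLY_inf_def
proof (rule cInf_lower)
  show "bdd_below {kappa_LLY G x y |x y. x \<in> verts G \<and> y \<in> verts G \<and> gd x y = real i}"
  proof (rule bdd_belowI[of _ "- 2 / real i"])
    fix k assume "k \<in> {kappa_LLY G x y |x y. x \<in> verts G \<and> y \<in> verts G \<and> gd x y = real i}"
    then obtain u v where uv: "k = kappa_LLY G u v" "u \<in> verts G" "v \<in> verts G" "gd u v = real i" by blast
    then have "u \<noteq> v" using gdist_self assms(4) by auto
    then show "- 2 / real i \<le> k" using kappa_LLY_lower_bound uv by metis
  qed
qed (use assms in blast)

section \<open>Cuts and separating sets\<close>

lemma adj_induce_subgraph: "u \<rightarrow>\<^bsub>G \<restriction> T\<^esub> v \<longleftrightarrow> u \<rightarrow>\<^bsub>G\<^esub> v \<and> u \<in> T \<and> v \<in> T"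
  by (auto simp: arcs_ends_conv)

text \<open>Connectedness is strong connectedness of the symmetric closure, and taking that closure
  leaves reachability unchanged because the arcs are already symmetric.\<close>

lemma connected_induce_subgraph_iff:
  assumes "T \<subseteq> verts G"
  shows "Digraph_Component.connected (G \<restriction> T) \<longleftrightarrow> T \<noteq> {} \<and> (\<forall>u\<in>T. \<forall>v\<in>T. u \<rightarrow>\<^sup>*\<^bsub>G \<restriction> T\<^esub> v)"
proof -
  interpret T: wf_digraph "G \<restriction> T" by (rule wellformed_induce_subgraph)
  have "symmetric (G \<restriction> T)"
    using graph_symmetric by (auto simp: symmetric_def sym_def adj_induce_subgraph)
  moreover have "verts (with_proj (mk_symmetric (G \<restriction> T))) = T"
    by (simp add: mk_symmetric_def)
  ultimately show ?thesis
    by (simp add: Digraph_Component.connected_def strongly_connected_def T.reachable_mk_symmetric_eq)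
qed

text \<open>Forward, \<open>X\<close> is all that is reachable inside \<open>T\<close> from a vertex
  that fails to reach another one. Backward, no walk inside \<open>T\<close> can leave
  \<open>X\<close>.\<close>

lemma disconnected_induce_subgraph_iff:
  assumes "T \<subseteq> verts G" "T \<noteq> {}"
  shows "\<not> Digraph_Component.connected (G \<restriction> T) \<longleftrightarrow>
    (\<exists>X Y. X \<noteq> {} \<and> Y \<noteq> {} \<and> X \<union> Y = T \<and> X \<inter> Y = {} \<and> (\<forall>u\<in>X. \<forall>v\<in>Y. \<not> u \<rightarrow>\<^bsub>G\<^esub> v))"
    (is "_ \<longleftrightarrow> ?cut")
proof
  interpret T: wf_digraph "G \<restriction> T" by (rule wellformed_induce_subgraph)
  assume "\<not> Digraph_Component.connected (G \<restriction> T)"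
  then obtain u v where uv: "u \<in> T" "v \<in> T" "\<not> u \<rightarrow>\<^sup>*\<^bsub>G \<restriction> T\<^esub> v"
    using assms connected_induce_subgraph_iff by blast
  define X where "X = {w. u \<rightarrow>\<^sup>*\<^bsub>G \<restriction> T\<^esub> w}"
  have "X \<subseteq> T" using T.reachable_in_verts(2) by (auto simp: X_def)
  moreover have "u \<in> X" "v \<in> T - X" using uv by (auto simp: X_def)
  moreover have "\<not> a \<rightarrow>\<^bsub>G\<^esub> b" if "a \<in> X" "b \<in> T - X" for a b
    using that \<open>X \<subseteq> T\<close> T.reachable_adj_trans[of u a b] by (auto simp: X_def adj_induce_subgraph)
  ultimately show ?cut by (intro exI[of _ X] exI[of _ "T - X"]) auto
next
  interpret T: wf_digraph "G \<restriction> T" by (rule wellformed_induce_subgraph)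
  assume ?cut
  then obtain X Y where XY: "X \<noteq> {}" "Y \<noteq> {}" "X \<union> Y = T" "X \<inter> Y = {}"
    "\<forall>u\<in>X. \<forall>v\<in>Y. \<not> u \<rightarrow>\<^bsub>G\<^esub> v" by blast
  then obtain u v where "u \<in> X" "v \<in> Y" by blast
  then have "\<not> u \<rightarrow>\<^sup>*\<^bsub>G \<restriction> T\<^esub> v"
    using XY T.reachable_closed[of u v X] by (auto simp: adj_induce_subgraph)
  then show "\<not> Digraph_Component.connected (G \<restriction> T)"
    using \<open>u \<in> X\<close> \<open>v \<in> Y\<close> XY connected_induce_subgraph_iff[OF assms(1)] by blast
qed

text \<open>Removing the neighbours of \<open>u\<close> isolates \<open>u\<close> from a
  non-adjacent \<open>v\<close>. Hence the \<open>LEAST\<close> in \<open>connectivity\<close> is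
  attained.\<close>

lemma finite_separating_set_exists:
  assumes "\<not> complete_graph G"
  shows "\<exists>S. separating_set G S \<and> finite S"
proof -
  obtain u v where uv: "u \<in> verts G" "v \<in> verts G" "u \<noteq> v" "\<not> u \<rightarrow>\<^bsub>G\<^esub> v"
    using assms by (auto simp: complete_graph_def)
  let ?T = "verts G - nbrs u"
  have "\<not> Digraph_Component.connected (G \<restriction> ?T)"
  proof (subst disconnected_induce_subgraph_iff)
    show "\<exists>X Y. X \<noteq> {} \<and> Y \<noteq> {} \<and> X \<union> Y = ?T \<and> X \<inter> Y = {} \<and> (\<forall>u\<in>X. \<forall>v\<in>Y. \<not> u \<rightarrow>\<^bsub>G\<^esub> v)"
      using uv adj_not_same[of u] by (intro exI[of _ "{u}"] exI[of _ "?T - {u}"]) auto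
  qed (use uv in auto)
  then show ?thesis
    using uv nbrs_subset_verts finite_nbrs unfolding separating_set_def by (intro exI[of _ "nbrs u"]) auto
qed

lemma minimum_separating_set:
  assumes "\<not> complete_graph G"
  obtains S where "separating_set G S" "finite S" "card S = connectivity G"
    "\<And>S'. separating_set G S' \<Longrightarrow> finite S' \<Longrightarrow> card S \<le> card S'"
proof -
  let ?P = "\<lambda>k. \<exists>S. separating_set G S \<and> finite S \<and> card S = k"
  have "?P (connectivity G)"
    unfolding connectivity_def by (rule LeastI_ex) (use finite_separating_set_exists[OF assms] in blast)
  moreover have "connectivity G \<le> card S'" if "separating_set G S'" "finite S'" for S'
    unfolding connectivity_def by (rule Least_le) (use that in blast)
  ultimately show ?thesis using that by metis
qed

text \<open>By minimality every vertex of a minimum separating set has neighbours on both sides.\<close>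

lemma minimum_cut:
  assumes "\<not> complete_graph G"
  obtains X Y S s x y where "finite S" "card S = connectivity G" "X \<union> Y \<union> S = verts G"
    "X \<inter> Y = {}" "X \<inter> S = {}" "Y \<inter> S = {}" "\<forall>u\<in>X. \<forall>v\<in>Y. \<not> u \<rightarrow>\<^bsub>G\<^esub> v"
    "x \<in> X" "y \<in> Y" "x \<rightarrow>\<^bsub>G\<^esub> s" "s \<rightarrow>\<^bsub>G\<^esub> y"
proof -
  obtain S where S: "separating_set G S" "finite S" "card S = connectivity G"
    and least: "\<And>S'. separating_set G S' \<Longrightarrow> finite S' \<Longrightarrow> card S \<le> card S'"
    using minimum_separating_set[OF assms] by blast
  have SV: "S \<subset> verts G" using S(1) by (simp add: separating_set_def)
  then have "verts G - S \<subseteq> verts G" "verts G - S \<noteq> {}" by auto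
  then obtain X Y where XY: "X \<noteq> {}" "Y \<noteq> {}" "X \<union> Y = verts G - S" "X \<inter> Y = {}"
    and no_arcs: "\<forall>u\<in>X. \<forall>v\<in>Y. \<not> u \<rightarrow>\<^bsub>G\<^esub> v"
    using S(1) disconnected_induce_subgraph_iff[of "verts G - S"] unfolding separating_set_def by metis
  have no_arc: "\<not> u \<rightarrow>\<^bsub>G\<^esub> v" if "u \<in> X" "v \<in> Y" for u v
    using no_arcs that by blast
  have no_arc_back: "\<not> v \<rightarrow>\<^bsub>G\<^esub> u" if "u \<in> X" "v \<in> Y" for u v
    using no_arc[OF that] graph_symmetric by blast
  \<comment> \<open>An empty \<open>S\<close> would make \<open>X\<close> closed under arcs, against
    connectedness of \<open>G\<close>.\<close>
  have "S \<noteq> {}"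
  proof
    assume "S = {}"
    obtain u v where uv: "u \<in> X" "v \<in> Y" using XY by blast
    then have "u \<rightarrow>\<^sup>*\<^bsub>G\<^esub> v" using XY reachable_verts by blast
    moreover have "b \<in> X" if "a \<in> X" "a \<rightarrow>\<^bsub>G\<^esub> b" for a b
      using that no_arc XY \<open>S = {}\<close> nbrs_subset_verts[of a] by blast
    ultimately have "v \<in> X" using uv reachable_closed by metis
    then show False using uv XY by blast
  qed
  then obtain s where s: "s \<in> S" by blast
  \<comment> \<open>With \<open>s\<close> put back, the removed set is smaller than the minimum and
    no longer separates.\<close>
  let ?T = "verts G - (S - {s})"
  have "card (S - {s}) < card S" using s S(2) by (meson card_Diff1_less)
  then have "Digraph_Component.connected (G \<restriction> ?T)"
    using least[of "S - {s}"] S(2) SV unfolding separating_set_def by fastforce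
  moreover have "?T \<subseteq> verts G" "?T \<noteq> {}" using s SV by auto
  ultimately have no_cut: "\<exists>u\<in>A. \<exists>v\<in>B. u \<rightarrow>\<^bsub>G\<^esub> v"
    if "A \<noteq> {}" "B \<noteq> {}" "A \<union> B = ?T" "A \<inter> B = {}" for A B
    using disconnected_induce_subgraph_iff[of ?T] that by metis
  \<comment> \<open>The vertex \<open>s\<close> may join either side. Both partitions of
    \<open>?T\<close> must be crossed by an arc, and coming from the side without \<open>s\<close>
    it can only end in \<open>s\<close>.\<close>
  have T: "X \<union> insert s Y = ?T" "Y \<union> insert s X = ?T" "X \<inter> insert s Y = {}" "Y \<inter> insert s X = {}"
    using XY s SV by auto
  obtain x where x: "x \<in> X" "x \<rightarrow>\<^bsub>G\<^esub> s"
    using no_cut[OF XY(1) _ T(1,3)] no_arc by auto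
  obtain y where y: "y \<in> Y" "y \<rightarrow>\<^bsub>G\<^esub> s"
    using no_cut[OF XY(2) _ T(2,4)] no_arc_back by auto
  show ?thesis
    by (rule that[OF S(2,3) _ XY(4) _ _ no_arcs x(1) y(1) x(2)])
       (use XY SV y graph_symmetric in auto)
qed

section \<open>Curvature across a minimum cut\<close>

lemma connectivity_ge:
  assumes "\<not> complete_graph G"
  shows "real (min_degree G) * kappa_LLY_inf G 2 \<le> real (connectivity G)"
\<comment> \<open>For minimum degree 0 the left-hand side vanishes; otherwise it may be divided
  by.\<close>
proof (cases "min_degree G = 0")
  case False
  obtain X Y S s x y where S: "finite S" "card S = connectivity G" "X \<union> Y \<union> S = verts G"
    "X \<inter> Y = {}" "X \<inter> S = {}" "Y \<inter> S = {}"
    and no_arcs: "\<forall>u\<in>X. \<forall>v\<in>Y. \<not> u \<rightarrow>\<^bsub>G\<^esub> v"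
    and xy: "x \<in> X" "y \<in> Y" "x \<rightarrow>\<^bsub>G\<^esub> s" "s \<rightarrow>\<^bsub>G\<^esub> y"
    by (rule minimum_cut[OF assms])
  have no_arc: "\<not> u \<rightarrow>\<^bsub>G\<^esub> v" if "u \<in> X" "v \<in> Y" for u v
    using no_arcs that by blast
  have V: "x \<in> verts G" "y \<in> verts G" "s \<in> verts G" "x \<noteq> y"
    using S(3,4) xy nbrs_subset_verts[of x] by auto
  have d: "gd x y = 2"
    using gdist_ge_2[OF V(1,2,4)] no_arc[OF xy(1,2)] gdist_triangle[OF V(1,3,2)]
      gdist_adj_le_1[OF xy(3)] gdist_adj_le_1[OF xy(4)] by simp
  define f :: "'a \<Rightarrow> real" where "f u = of_bool (u \<in> X) - of_bool (u \<in> Y)" for u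
  define M where "M = real (connectivity G) / real (min_degree G)"
  have M: "real (card (nbrs z \<inter> S)) / real (out_degree G z) \<le> M" if "z \<in> verts G" for z
  proof -
    have "min_degree G \<le> out_degree G z"
      unfolding min_degree_def by (rule cINF_lower) (use that in auto)
    moreover have "card (nbrs z \<inter> S) \<le> connectivity G"
      using card_mono[OF S(1)] S(2) by (metis Int_lower2)
    ultimately show ?thesis unfolding M_def using False by (intro frac_le) auto
  qed
  have "kappa_LLY G x y \<le> M"
  proof (rule kappa_LLY_le[OF V(1,2,4)])
    fix p :: real assume p: "0 \<le> p" "p < 1"
    have "kappa G p x y / (1 - p) \<le> 2 * M / gd x y"
    proof (rule kappa_slope_le_Lipschitz[OF V(1,2,4) p, where f = f])
      \<comment> \<open>The difference is at most 2, and equals 2 only from \<open>X\<close> to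
        \<open>Y\<close>, where the absence of arcs gives distance at least 2.\<close>
      show "f u - f v \<le> gd u v" if "u \<in> verts G" "v \<in> verts G" for u v
      proof (cases "u = v")
        case True
        then show ?thesis using gdist_nonneg that by simp
      next
        case False
        then show ?thesis
          using gdist_ge_1[OF that] gdist_ge_2[OF that] no_arc S(4) by (auto simp: f_def)
      qed
      show "f x - f y = gd x y" using xy S(4) d by (auto simp: f_def)
      \<comment> \<open>A neighbour of \<open>x\<close> lies in \<open>X\<close>, where
        \<open>f\<close> is unchanged, or in \<open>S\<close>, where it drops by 1. At
        \<open>y\<close> the situation is mirrored.\<close>
      have "f z - f x = - of_bool (z \<in> S)" if "z \<in> nbrs x" for z
        using that no_arc[OF xy(1)] xy S(3-6) nbrs_subset_verts[of x] by (auto simp: f_def)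
      then have "(\<Sum>z\<in>nbrs x. f z - f x) = - real (card (nbrs x \<inter> S))"
        using finite_nbrs[OF V(1)] by (simp add: sum_negf Int_def)
      then show "- M \<le> (\<Sum>z\<in>nbrs x. f z - f x) / out_degree G x" using M[OF V(1)] by simp
      have "f z - f y = of_bool (z \<in> S)" if "z \<in> nbrs y" for z
        using that no_arc[OF _ xy(2)] graph_symmetric xy S(3-6) nbrs_subset_verts[of y] by (auto simp: f_def)
      then have "(\<Sum>z\<in>nbrs y. f z - f y) = real (card (nbrs y \<inter> S))"
        using finite_nbrs[OF V(2)] by (simp add: Int_def)
      then show "(\<Sum>z\<in>nbrs y. f z - f y) / out_degree G y \<le> M" using M[OF V(2)] by simp
    qed
    \<comment> \<open>The distance 2 cancels the factor 2 coming from the two endpoints.\<close>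
    then show "kappa G p x y / (1 - p) \<le> M" using d by simp
  qed
  then have "kappa_LLY_inf G 2 \<le> M"
    using kappa_LLY_inf_le[of x y 2] V d by simp
  then show ?thesis using False by (simp add: M_def field_simps)
qed simp

end

theorem theorem1p1:
  fixes G :: "('a, 'b) pre_digraph"
  assumes "locally_finite_graph G"
    and "Digraph_Component.connected G"
    and "\<not> complete_graph G"
  shows "real (connectivity G) \<ge> real (min_degree G) * kappa_LLY_inf G 2"
proof -
  interpret connected_locally_finite_graph G
    using assms(1,2) by (intro connected_locally_finite_graph.intro connected_locally_finite_graph_axioms.intro)
  show ?thesis using assms(3) by (rule connectivity_ge)
qed

end
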